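(* Let $(Y_i(1),Y_i(0),R_i(1),R_i(0),X_i)$ be a random vector with $Y_i(d)$ real-valued, $R_i(d)\in\{0,1\}$, $E[|Y_i(d)|]<\infty$ and $E[R_i(d)]>0$ for $d\in\{0,1\}$, and $X_i$ a vector of covariates. Define \[\theta=E[Y_i(1)-Y_i(0)],\qquad \tau(x)=E[Y_i(1)-Y_i(0)\mid X_i=x],\] \[\theta^{\rm obs}=E[Y_i(1)\mid R_i(1)=1]-E[Y_i(0)\mid R_i(0)=1],\qquad \theta^{\rm drop}=E[\tau^{\rm obs}(X_i)\rho(X_i)],\] where \[\tau^{\rm obs}(x)=E[Y_i(1)\mid R_i(1)=1,X_i=x]-E[Y_i(0)\mid R_i(0)=1,X_i=x],\] \[\rho(x)=\frac{E[R_i(0)\mid X_i=x]\,E[R_i(1)\mid X_i=x]}{E\big[E[R_i(0)\mid X_i]\,E[R_i(1)\mid X_i]\big]}.\] Then: (a) If $(Y_i(1),Y_i(0))\perp\!\!\!\perp(R_i(1),R_i(0))$, then $\theta^{\rm obs}=\theta$. (b) If $(Y_i(1),Y_i(0))\perp\!\!\!\perp(R_i(1),R_i(0))\mid X_i$, then $\theta^{\rm drop}=E[\tau(X_i)\rho(X_i)]$. (c) If $X_i\perp\!\!\!\perp(R_i(1),R_i(0))$, then $\theta^{\rm drop}=\theta^{\rm obs}$. (d) If $X_i\perp\!\!\!\perp(R_i(1),R_i(0))$ and either $(Y_i(1),Y_i(0))\perp\!\!\!\perp(R_i(1),R_i(0))$ or $(Y_i(1),Y_i(0))\perp\!\!\!\perp(R_i(1),R_i(0))\mid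 X_i$, then $\theta^{\rm drop}=\theta$.
   Context: $Y_i(d)$ is the potential outcome and $R_i(d)$ the potential response indicator ($1$ = not attrited) of unit $i$ under treatment $d\in\{0,1\}$; $X_i$ are the matching covariates; $\theta$ is the average treatment effect. $\perp\!\!\!\perp$ denotes (conditional) independence. $\theta^{\rm obs}$ and $\theta^{\rm drop}$ are the probability limits, in a matched-pair design, of the difference-in-means estimator keeping, respectively dropping, the pairs with an attrited unit. *)

theory Defs
  imports "HOL-Probability.Probability"
begin

definition sigma_gen :: "'w measure \<Rightarrow> ('w \<Rightarrow> 'b::topological_space) \<Rightarrow> 'w measure" where
  "sigma_gen M Z = vimage_algebra (space M) Z borel"

text \<open>The library constant \<open>indep_var\<close> forces both variables to have the same type.\<close>

definition indep_rv ::
  "'w measure \<Rightarrow> ('w \<Rightarrow> 'b::topological_space) \<Rightarrow> ('w \<Rightarrow> 'c::topological_space) \<Rightarrow> bool" where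
  "indep_rv M U V \<longleftrightarrow>
    prob_space.indep_set M (sets (sigma_gen M U)) (sets (sigma_gen M V))"

definition cond_indep_rv ::
  "'w measure \<Rightarrow> ('w \<Rightarrow> 'b::topological_space) \<Rightarrow> ('w \<Rightarrow> 'c::topological_space) \<Rightarrow>
    ('w \<Rightarrow> 'd::topological_space) \<Rightarrow> bool" where
  "cond_indep_rv M U V Z \<longleftrightarrow>
    (\<forall>A\<in>sets borel. \<forall>B\<in>sets borel. AE \<omega> in M.
      real_cond_exp M (sigma_gen M Z) (indicat_real {\<omega> \<in> space M. U \<omega> \<in> A \<and> V \<omega> \<in> B}) \<omega> =
      real_cond_exp M (sigma_gen M Z) (indicat_real {\<omega> \<in> space M. U \<omega> \<in> A}) \<omega> *
      real_cond_exp M (sigma_gen M Z) (indicat_real {\<omega> \<in> space M. V \<omega> \<in> B}) \<omega>)"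

definition cond_exp_event :: "'w measure \<Rightarrow> ('w \<Rightarrow> real) \<Rightarrow> 'w set \<Rightarrow> real" where
  "cond_exp_event M f A = integral\<^sup>L (uniform_measure M A) f"

text \<open>
  \<open>cond_exp_at M Z f z\<close> is \<open>E[f | Z = z]\<close>: a Borel function of \<open>z\<close> whose composition with \<open>Z\<close>
  is a version of \<open>E[f | Z]\<close>.  Such a function is determined up to null sets of the law of \<open>Z\<close>;
  one version is selected.  It always exists, see \<open>cond_exp_at_version\<close>.
\<close>

definition cond_exp_at ::
  "'w measure \<Rightarrow> ('w \<Rightarrow> 'b::topological_space) \<Rightarrow> ('w \<Rightarrow> real) \<Rightarrow> 'b \<Rightarrow> real" where
  "cond_exp_at M Z f = (SOME g. g \<in> borel_measurable borel \<and>
    (AE \<omega> in M. g (Z \<omega>) = real_cond_exp M (sigma_gen M Z) f \<omega>))"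

lemma borel_measurable_vimage_factor:
  fixes h :: "'w \<Rightarrow> real"
  assumes h: "h \<in> borel_measurable (vimage_algebra S Z N)" and Z: "Z \<in> S \<rightarrow> space N"
  obtains g where "g \<in> borel_measurable N" "\<And>\<omega>. \<omega> \<in> S \<Longrightarrow> g (Z \<omega>) = h \<omega>"
proof -
  have "\<exists>B\<in>sets N. {\<omega> \<in> S. of_rat q < h \<omega>} = Z -` B \<inter> S" for q
  proof -
    have "{\<omega> \<in> space (vimage_algebra S Z N). of_rat q < h \<omega>} \<in> sets (vimage_algebra S Z N)"
      using h by measurable
    then show ?thesis
      by (auto simp: sets_vimage_algebra2[OF Z])
  qed
  then obtain B where B: "\<And>q. B q \<in> sets N" "\<And>q. {\<omega> \<in> S. of_rat q < h \<omega>} = Z -` B q \<inter> S"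
    by metis
  define G :: "_ \<Rightarrow> ereal"
    where "G z = (SUP q. if z \<in> B q then ereal (of_rat q) else - \<infinity>)" for z
  have [measurable]: "G \<in> borel_measurable N"
    unfolding G_def using B(1) by measurable
  have "G (Z \<omega>) = ereal (h \<omega>)" if "\<omega> \<in> S" for \<omega>
  proof -
    have mem: "Z \<omega> \<in> B q \<longleftrightarrow> of_rat q < h \<omega>" for q
      using B(2)[of q] that by blast
    show ?thesis
    proof (rule antisym)
      show "G (Z \<omega>) \<le> ereal (h \<omega>)"
        unfolding G_def by (rule SUP_least) (auto simp: mem)
      show "ereal (h \<omega>) \<le> G (Z \<omega>)"
      proof (rule dense_le)
        fix y assume "y < ereal (h \<omega>)"
        then obtain r where r: "y < ereal r" "r < h \<omega>"
          using ereal_dense2 by force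
        obtain q where q: "r < of_rat q" "of_rat q < h \<omega>"
          using of_rat_dense[OF r(2)] by blast
        have "y \<le> ereal (of_rat q)"
          using r q by (metis less_ereal.simps(1) less_imp_le less_trans)
        also have "\<dots> \<le> G (Z \<omega>)"
          unfolding G_def by (rule SUP_upper2[of q]) (auto simp: mem q)
        finally show "y \<le> G (Z \<omega>)" .
      qed
    qed
  qed
  then show ?thesis
    by (intro that[of "\<lambda>z. real_of_ereal (G z)"]) auto
qed

lemma cond_exp_at_version:
  shows "cond_exp_at M Z f \<in> borel_measurable borel"
    and "AE \<omega> in M. cond_exp_at M Z f (Z \<omega>) = real_cond_exp M (sigma_gen M Z) f \<omega>"
proof -
  have "real_cond_exp M (sigma_gen M Z) f \<in> borel_measurable (vimage_algebra (space M) Z borel)"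
    unfolding sigma_gen_def by (rule borel_measurable_cond_exp)
  then obtain g where "g \<in> borel_measurable borel"
    and "\<And>\<omega>. \<omega> \<in> space M \<Longrightarrow> g (Z \<omega>) = real_cond_exp M (sigma_gen M Z) f \<omega>"
    by (rule borel_measurable_vimage_factor) auto
  then have "\<exists>g. g \<in> borel_measurable borel \<and>
      (AE \<omega> in M. g (Z \<omega>) = real_cond_exp M (sigma_gen M Z) f \<omega>)"
    by (intro exI[of _ g]) auto
  from someI_ex[OF this]
  show "cond_exp_at M Z f \<in> borel_measurable borel"
    and "AE \<omega> in M. cond_exp_at M Z f (Z \<omega>) = real_cond_exp M (sigma_gen M Z) f \<omega>"
    unfolding cond_exp_at_def by blast+
qed

definition theta :: "'w measure \<Rightarrow> ('w \<Rightarrow> real) \<Rightarrow> ('w \<Rightarrow> real) \<Rightarrow> real" where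
  "theta M Y1 Y0 = (\<integral>\<omega>. Y1 \<omega> - Y0 \<omega> \<partial>M)"

definition tau ::
  "'w measure \<Rightarrow> ('w \<Rightarrow> real) \<Rightarrow> ('w \<Rightarrow> real) \<Rightarrow> ('w \<Rightarrow> 'b::topological_space) \<Rightarrow> 'b \<Rightarrow> real" where
  "tau M Y1 Y0 X x = cond_exp_at M X (\<lambda>\<omega>. Y1 \<omega> - Y0 \<omega>) x"

definition theta_obs ::
  "'w measure \<Rightarrow> ('w \<Rightarrow> real) \<Rightarrow> ('w \<Rightarrow> real) \<Rightarrow> ('w \<Rightarrow> real) \<Rightarrow> ('w \<Rightarrow> real) \<Rightarrow> real" where
  "theta_obs M Y1 Y0 R1 R0 =
    cond_exp_event M Y1 {\<omega> \<in> space M. R1 \<omega> = 1} - cond_exp_event M Y0 {\<omega> \<in> space M. R0 \<omega> = 1}"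

text \<open>
  \<open>E[Y(d) | R(d) = 1, X = x]\<close> is the regression function of \<open>Y(d)\<close> on the pair \<open>(R(d), X)\<close>,
  evaluated at \<open>(1, x)\<close>.
\<close>

definition tau_obs ::
  "'w measure \<Rightarrow> ('w \<Rightarrow> real) \<Rightarrow> ('w \<Rightarrow> real) \<Rightarrow> ('w \<Rightarrow> real) \<Rightarrow> ('w \<Rightarrow> real) \<Rightarrow>
    ('w \<Rightarrow> 'b::topological_space) \<Rightarrow> 'b \<Rightarrow> real" where
  "tau_obs M Y1 Y0 R1 R0 X x =
    cond_exp_at M (\<lambda>\<omega>. (R1 \<omega>, X \<omega>)) Y1 (1, x) - cond_exp_at M (\<lambda>\<omega>. (R0 \<omega>, X \<omega>)) Y0 (1, x)"

text \<open>
  If the normalizing constant vanishes, the weight is undefined in the mathematics and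
  \<open>0\<close> here, by \<open>x / 0 = 0\<close>.
\<close>

definition rho ::
  "'w measure \<Rightarrow> ('w \<Rightarrow> real) \<Rightarrow> ('w \<Rightarrow> real) \<Rightarrow> ('w \<Rightarrow> 'b::topological_space) \<Rightarrow> 'b \<Rightarrow> real" where
  "rho M R1 R0 X x =
    cond_exp_at M X R0 x * cond_exp_at M X R1 x /
    (\<integral>\<omega>. real_cond_exp M (sigma_gen M X) R0 \<omega> * real_cond_exp M (sigma_gen M X) R1 \<omega> \<partial>M)"

definition theta_drop ::
  "'w measure \<Rightarrow> ('w \<Rightarrow> real) \<Rightarrow> ('w \<Rightarrow> real) \<Rightarrow> ('w \<Rightarrow> real) \<Rightarrow> ('w \<Rightarrow> real) \<Rightarrow>
    ('w \<Rightarrow> 'b::topological_space) \<Rightarrow> real" where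
  "theta_drop M Y1 Y0 R1 R0 X =
    (\<integral>\<omega>. tau_obs M Y1 Y0 R1 R0 X (X \<omega>) * rho M R1 R0 X (X \<omega>) \<partial>M)"

end

theory Submission
  imports Defs
begin

text \<open>
  Write \<open>p\<^sub>d = E[R(d) | X]\<close> and \<open>h\<^sub>d(x) = E[Y(d) | R(d) = 1, X = x]\<close>.  Everything rests on the identity
  \<open>E[R(d) Y(d) | X] = h\<^sub>d(X) p\<^sub>d\<close>, which holds almost surely although \<open>h\<^sub>d(X)\<close> itself need not be
  integrable.  Under conditional independence the left-hand side is \<open>E[Y(d) | X] p\<^sub>d\<close>, so \<open>h\<^sub>d(X)\<close> may
  be replaced by \<open>E[Y(d) | X]\<close> wherever it is multiplied by \<open>p\<^sub>0 p\<^sub>1\<close>.  If \<open>X\<close> is independent of the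
  response, then \<open>p\<^sub>d\<close> is the constant \<open>E[R(d)]\<close>, hence \<open>\<rho> = 1\<close>, and integrating the identity gives
  \<open>E[h\<^sub>d(X)] = E[R(d) Y(d)] / E[R(d)] = E[Y(d) | R(d) = 1]\<close>.
\<close>

section \<open>Sigma-algebras generated by random variables\<close>

lemma space_sigma_gen [simp]: "space (sigma_gen M Z) = space M"
  by (simp add: sigma_gen_def)

lemma sets_sigma_gen: "sets (sigma_gen M Z) = {Z -` A \<inter> space M |A. A \<in> sets borel}"
  unfolding sigma_gen_def by (rule sets_vimage_algebra2) auto

lemma measurable_sigma_gen: "Z \<in> borel_measurable (sigma_gen M Z)"
  unfolding sigma_gen_def by (rule measurable_vimage_algebra1) auto

text \<open>Minimality of the generated sigma-algebra. \<open>N\<close> is left general because two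
  choices occur: \<open>M\<close> itself, and the sigma-algebra of the pair (R, Z), which is finer
  than that of Z.\<close>

lemma sets_sigma_gen_subset: "Z \<in> borel_measurable N \<Longrightarrow> space N = space M \<Longrightarrow>
    sets (sigma_gen M Z) \<subseteq> sets N"
  by (auto simp: sets_sigma_gen dest!: measurable_sets)

context prob_space
begin

lemma finite_measure_subalgebra_sigma_gen:
  assumes "Z \<in> borel_measurable M"
  shows "finite_measure_subalgebra M (sigma_gen M Z)"
  by unfold_locales (use sets_sigma_gen_subset[OF assms] in \<open>auto simp: subalgebra_def\<close>)

section \<open>Independence and conditional independence: from events to integrable
  functions\<close>

text \<open>The tests against indicators of events of Y say exactly that E[f | Y] = E[g | Y] almost
  surely. Pulling the factor Y out of the conditional expectation then gives the claim, with no
  approximation of Y by simple functions.\<close>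

lemma integral_mult_eqI:
  fixes Y f g :: "'a \<Rightarrow> real"
  assumes [measurable]: "Y \<in> borel_measurable M"
    and f: "integrable M f" and g: "integrable M g"
    and Yf: "integrable M (\<lambda>\<omega>. Y \<omega> * f \<omega>)" and Yg: "integrable M (\<lambda>\<omega>. Y \<omega> * g \<omega>)"
    and eq: "\<And>A. A \<in> sets borel \<Longrightarrow>
      (\<integral>\<omega>. indicator A (Y \<omega>) * f \<omega> \<partial>M) = (\<integral>\<omega>. indicator A (Y \<omega>) * g \<omega> \<partial>M)"
  shows "(\<integral>\<omega>. Y \<omega> * f \<omega> \<partial>M) = (\<integral>\<omega>. Y \<omega> * g \<omega> \<partial>M)"
proof -
  let ?F = "sigma_gen M Y"
  interpret F: finite_measure_subalgebra M ?F
    by (rule finite_measure_subalgebra_sigma_gen) fact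
  have Y: "Y \<in> borel_measurable ?F"
    by (rule measurable_sigma_gen)
  \<comment> \<open>Every set of the sigma-algebra of Y is a preimage of a Borel set, so the
    hypothesis \<open>eq\<close> is the defining property of the conditional expectation.\<close>
  have ae: "AE \<omega> in M. real_cond_exp M ?F f \<omega> = real_cond_exp M ?F g \<omega>"
  proof (rule F.real_cond_exp_charact)
    fix C assume C: "C \<in> sets ?F"
    then obtain A where A: "A \<in> sets borel" "C = Y -` A \<inter> space M"
      by (auto simp: sets_sigma_gen)
    have *: "(\<integral>\<omega>\<in>C. u \<omega> \<partial>M) = (\<integral>\<omega>. indicator A (Y \<omega>) * u \<omega> \<partial>M)" for u :: "'a \<Rightarrow> real"
      unfolding set_lebesgue_integral_def
      by (rule Bochner_Integration.integral_cong) (auto simp: A indicator_def)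
    have "(\<integral>\<omega>\<in>C. f \<omega> \<partial>M) = (\<integral>\<omega>\<in>C. g \<omega> \<partial>M)"
      by (simp only: * eq[OF A(1)])
    also have "\<dots> = (\<integral>\<omega>\<in>C. real_cond_exp M ?F g \<omega> \<partial>M)"
      by (rule F.real_cond_exp_intA[OF g C])
    finally show "(\<integral>\<omega>\<in>C. f \<omega> \<partial>M) = (\<integral>\<omega>\<in>C. real_cond_exp M ?F g \<omega> \<partial>M)" .
  qed (use f g in \<open>auto intro: F.real_cond_exp_int\<close>)
  have "(\<integral>\<omega>. Y \<omega> * f \<omega> \<partial>M) = (\<integral>\<omega>. Y \<omega> * real_cond_exp M ?F f \<omega> \<partial>M)"
    by (rule F.real_cond_exp_intg(2)[OF Yf Y, symmetric]) (use f in auto)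
  also have "\<dots> = (\<integral>\<omega>. Y \<omega> * real_cond_exp M ?F g \<omega> \<partial>M)"
    using ae by (intro integral_cong_AE) auto
  also have "\<dots> = (\<integral>\<omega>. Y \<omega> * g \<omega> \<partial>M)"
    by (rule F.real_cond_exp_intg(2)[OF Yg Y]) (use g in auto)
  finally show ?thesis .
qed

text \<open>Bridge from independence of sigma-algebras to \<open>indep_var\<close>, for which the
  product formula for expectations holds. It works because a Borel function of W generates a smaller
  sigma-algebra than W.\<close>

lemma indep_rv_compose:
  fixes f :: "'b::topological_space \<Rightarrow> real" and g :: "'c::topological_space \<Rightarrow> real"
  assumes ind: "indep_rv M U V"
    and [measurable]: "U \<in> borel_measurable M" "V \<in> borel_measurable M"
      "f \<in> borel_measurable borel" "g \<in> borel_measurable borel"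
  shows "indep_var borel (\<lambda>\<omega>. f (U \<omega>)) borel (\<lambda>\<omega>. g (V \<omega>))"
proof -
  \<comment> \<open>The type of W is kept generic, so that the inclusion serves both U and
    V.\<close>
  have sub: "sigma_sets (space M) {(\<lambda>\<omega>. f (W \<omega>)) -` A \<inter> space M |A. A \<in> sets borel}
      \<subseteq> sets (sigma_gen M W)" if [measurable]: "f \<in> borel_measurable borel"
    for f :: "'d::topological_space \<Rightarrow> real" and W :: "'a \<Rightarrow> 'd"
  proof -
    have "(\<lambda>\<omega>. f (W \<omega>)) \<in> borel_measurable (sigma_gen M W)"
      using measurable_sigma_gen[of W M] by measurable
    from measurable_sets[OF this] show ?thesis
      by (intro sets.sigma_sets_subset[where M="sigma_gen M W", simplified]) auto
  qed
  show ?thesis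
    unfolding indep_var_eq indep_sets2_eq
  proof (intro conjI ballI)
    fix a b
    assume "a \<in> sigma_sets (space M) {(\<lambda>\<omega>. f (U \<omega>)) -` A \<inter> space M |A. A \<in> sets borel}"
      and "b \<in> sigma_sets (space M) {(\<lambda>\<omega>. g (V \<omega>)) -` A \<inter> space M |A. A \<in> sets borel}"
    with sub[of f U] sub[of g V] show "prob (a \<inter> b) = prob a * prob b"
      by (intro indep_setD[OF ind[unfolded indep_rv_def]]) auto
  next
    show "sigma_sets (space M) {(\<lambda>\<omega>. f (U \<omega>)) -` A \<inter> space M |A. A \<in> sets borel} \<subseteq> events"
      using sub[of f U] sets_sigma_gen_subset[of U M M] by auto
    show "sigma_sets (space M) {(\<lambda>\<omega>. g (V \<omega>)) -` A \<inter> space M |A. A \<in> sets borel} \<subseteq> events"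
      using sub[of g V] sets_sigma_gen_subset[of V M M] by auto
  qed measurable
qed

text \<open>The constant passes the defining test: a set of the sigma-algebra of Z is an event that
  Z lies in A, and the indicator of A at Z is independent of g(V). This is what makes the response
  probabilities given X constant.\<close>

lemma real_cond_exp_indep:
  fixes g :: "'c::topological_space \<Rightarrow> real"
  assumes ind: "indep_rv M Z V"
    and [measurable]: "Z \<in> borel_measurable M" "V \<in> borel_measurable M"
      "g \<in> borel_measurable borel"
    and int: "integrable M (\<lambda>\<omega>. g (V \<omega>))"
  shows "AE \<omega> in M. real_cond_exp M (sigma_gen M Z) (\<lambda>\<omega>. g (V \<omega>)) \<omega> = (\<integral>\<omega>. g (V \<omega>) \<partial>M)"
proof -
  interpret F: finite_measure_subalgebra M "sigma_gen M Z"
    by (rule finite_measure_subalgebra_sigma_gen) fact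
  show ?thesis
  proof (rule F.real_cond_exp_charact)
    fix C assume C: "C \<in> sets (sigma_gen M Z)"
    then obtain A where A[measurable]: "A \<in> sets borel" and CA: "C = Z -` A \<inter> space M"
      by (auto simp: sets_sigma_gen)
    have *: "(\<integral>\<omega>\<in>C. u \<omega> \<partial>M) = (\<integral>\<omega>. indicator A (Z \<omega>) * u \<omega> \<partial>M)" for u :: "'a \<Rightarrow> real"
      unfolding set_lebesgue_integral_def
      by (rule Bochner_Integration.integral_cong) (auto simp: CA indicator_def)
    have "(\<integral>\<omega>. indicator A (Z \<omega>) * g (V \<omega>) \<partial>M) =
        (\<integral>\<omega>. indicator A (Z \<omega>) \<partial>M) * (\<integral>\<omega>. g (V \<omega>) \<partial>M)"
    proof (rule indep_var_lebesgue_integral)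
      show "integrable M (\<lambda>\<omega>. indicat_real A (Z \<omega>))"
        by (rule integrable_const_bound[of _ 1]) (auto simp: indicator_def)
      show "indep_var borel (\<lambda>\<omega>. indicat_real A (Z \<omega>)) borel (\<lambda>\<omega>. g (V \<omega>))"
        by (rule indep_rv_compose[OF ind]) measurable
    qed fact
    then show "(\<integral>\<omega>\<in>C. g (V \<omega>) \<partial>M) = (\<integral>\<omega>\<in>C. (\<integral>\<omega>. g (V \<omega>) \<partial>M) \<partial>M)"
      by (simp add: *)
  qed (use int in auto)
qed

lemma integrable_binary:
  fixes R :: "'a \<Rightarrow> real"
  assumes [measurable]: "R \<in> borel_measurable M" and R01: "\<forall>\<omega>\<in>space M. R \<omega> \<in> {0, 1}"
  shows "integrable M R"
  by (rule integrable_const_bound[of _ 1]) (auto dest!: bspec[OF R01])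

text \<open>Conditional expectation preserves the bounds 0 and 1. With this bound, a product of an
  integrable function with a conditional response probability stays integrable.\<close>

lemma real_cond_exp_binary_bound:
  assumes [measurable]: "Z \<in> borel_measurable M" "R \<in> borel_measurable M"
    and R01: "\<forall>\<omega>\<in>space M. R \<omega> \<in> {0, 1}"
  shows "AE \<omega> in M. \<bar>real_cond_exp M (sigma_gen M Z) R \<omega>\<bar> \<le> 1"
proof -
  interpret F: finite_measure_subalgebra M "sigma_gen M Z"
    by (rule finite_measure_subalgebra_sigma_gen) fact
  have R: "integrable M R"
    by (rule integrable_binary[OF _ R01]) measurable
  have "AE \<omega> in M. real_cond_exp M (sigma_gen M Z) R \<omega> \<ge> 0"
    by (rule F.real_cond_exp_ge_c[OF R]) (auto dest!: bspec[OF R01])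
  moreover have "AE \<omega> in M. real_cond_exp M (sigma_gen M Z) R \<omega> \<le> 1"
    by (rule F.real_cond_exp_le_c[OF R]) (auto dest!: bspec[OF R01])
  ultimately show ?thesis
    by eventually_elim auto
qed

lemma integrable_mult_bounded:
  fixes Y p :: "'a \<Rightarrow> real"
  assumes Y: "integrable M Y" and [measurable]: "p \<in> borel_measurable M"
    and p: "AE \<omega> in M. \<bar>p \<omega>\<bar> \<le> 1"
  shows "integrable M (\<lambda>\<omega>. Y \<omega> * p \<omega>)"
proof (rule Bochner_Integration.integrable_bound[OF Y])
  show "AE \<omega> in M. norm (Y \<omega> * p \<omega>) \<le> norm (Y \<omega>)"
    using p by eventually_elim (auto simp: abs_mult intro: mult_left_le)
qed (use Y in auto)

text \<open>Conditional independence is defined through events only. As g(V) is 0 or 1, it is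
  already the indicator of an event, so only f(U) has to pass from indicators to an integrable
  function. That passage is \<open>integral_mult_eqI\<close>.\<close>

lemma real_cond_exp_cond_indep:
  fixes f :: "'b::topological_space \<Rightarrow> real" and g :: "'c::topological_space \<Rightarrow> real"
  assumes ind: "cond_indep_rv M U V Z"
    and [measurable]: "U \<in> borel_measurable M" "V \<in> borel_measurable M" "Z \<in> borel_measurable M"
      "f \<in> borel_measurable borel" "g \<in> borel_measurable borel"
    and int: "integrable M (\<lambda>\<omega>. f (U \<omega>))"
    and g01: "\<forall>\<omega>\<in>space M. g (V \<omega>) \<in> {0, 1}"
  shows "AE \<omega> in M. real_cond_exp M (sigma_gen M Z) (\<lambda>\<omega>. f (U \<omega>) * g (V \<omega>)) \<omega> =
    real_cond_exp M (sigma_gen M Z) (\<lambda>\<omega>. f (U \<omega>)) \<omega> *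
    real_cond_exp M (sigma_gen M Z) (\<lambda>\<omega>. g (V \<omega>)) \<omega>"
proof -
  let ?F = "sigma_gen M Z"
  let ?E = "real_cond_exp M ?F"
  define p where "p = ?E (\<lambda>\<omega>. g (V \<omega>))"
  interpret F: finite_measure_subalgebra M ?F
    by (rule finite_measure_subalgebra_sigma_gen) fact
  have [measurable]: "p \<in> borel_measurable ?F" "p \<in> borel_measurable M"
    by (simp_all add: p_def)
  have p1: "AE \<omega> in M. \<bar>p \<omega>\<bar> \<le> 1"
    unfolding p_def by (rule real_cond_exp_binary_bound) (use g01 in auto)
  have g1: "AE \<omega> in M. \<bar>g (V \<omega>)\<bar> \<le> 1"
    by (auto dest!: bspec[OF g01])
  \<comment> \<open>The case of events: f(U) is replaced by the indicator of its lying in A, and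
    g(V) is read as the indicator of g(V) = 1.\<close>
  have ci: "AE \<omega> in M. ?E (\<lambda>\<omega>. indicator A (f (U \<omega>)) * g (V \<omega>)) \<omega> =
      ?E (\<lambda>\<omega>. indicator A (f (U \<omega>))) \<omega> * p \<omega>" if A[measurable]: "A \<in> sets borel" for A
  proof -
    have A': "f -` A \<in> sets borel" and B': "g -` {1} \<in> sets borel"
      using measurable_sets[of f borel borel A] measurable_sets[of g borel borel "{1}"] by auto
    let ?AB = "{\<omega> \<in> space M. U \<omega> \<in> f -` A \<and> V \<omega> \<in> g -` {1}}"
    let ?A = "{\<omega> \<in> space M. U \<omega> \<in> f -` A}"
    let ?B = "{\<omega> \<in> space M. V \<omega> \<in> g -` {1}}"
    have [measurable]: "?AB \<in> sets M" "?A \<in> sets M" "?B \<in> sets M"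
      by measurable
    have "AE \<omega> in M. ?E (indicat_real ?AB) \<omega> = ?E (indicat_real ?A) \<omega> * ?E (indicat_real ?B) \<omega>"
      using ind A' B' unfolding cond_indep_rv_def by blast
    moreover have "AE \<omega> in M. ?E (indicat_real ?AB) \<omega> =
        ?E (\<lambda>\<omega>. indicator A (f (U \<omega>)) * g (V \<omega>)) \<omega>"
      by (rule F.real_cond_exp_cong) (auto dest!: bspec[OF g01] simp: indicator_def)
    moreover have "AE \<omega> in M. ?E (indicat_real ?A) \<omega> = ?E (\<lambda>\<omega>. indicator A (f (U \<omega>))) \<omega>"
      by (rule F.real_cond_exp_cong) (auto simp: indicator_def)
    moreover have "AE \<omega> in M. ?E (indicat_real ?B) \<omega> = p \<omega>"
      unfolding p_def
      by (rule F.real_cond_exp_cong) (auto dest!: bspec[OF g01] simp: indicator_def)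
    ultimately show ?thesis
      by eventually_elim simp
  qed
  have fp: "integrable M (\<lambda>\<omega>. f (U \<omega>) * p \<omega>)"
    by (rule integrable_mult_bounded[OF int _ p1]) measurable
  show ?thesis
    unfolding p_def[symmetric]
  proof (rule F.real_cond_exp_charact)
    show "integrable M (\<lambda>\<omega>. f (U \<omega>) * g (V \<omega>))"
      by (rule integrable_mult_bounded[OF int _ g1]) measurable
    show "integrable M (\<lambda>\<omega>. ?E (\<lambda>\<omega>. f (U \<omega>)) \<omega> * p \<omega>)"
      using F.real_cond_exp_intg(1)[of p "\<lambda>\<omega>. f (U \<omega>)"] fp by (simp add: mult.commute)
    show "(\<lambda>\<omega>. ?E (\<lambda>\<omega>. f (U \<omega>)) \<omega> * p \<omega>) \<in> borel_measurable ?F"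
      by measurable
  next
    fix C assume C[measurable]: "C \<in> sets ?F"
    then have [measurable]: "C \<in> sets M"
      using F.subalg by (auto simp: subalgebra_def)
    let ?C = "indicat_real C"
    have bnd: "AE \<omega> in M. \<bar>g (V \<omega>) * ?C \<omega>\<bar> \<le> 1" "AE \<omega> in M. \<bar>p \<omega> * ?C \<omega>\<bar> \<le> 1"
      using g1 p1 by (auto simp: indicator_def)
    \<comment> \<open>The weight p times the indicator of C is measurable with respect to
      \<open>?F\<close>, so Y may be exchanged for its conditional expectation under the
      integral.\<close>
    have swap: "(\<integral>\<omega>. Y \<omega> * (p \<omega> * ?C \<omega>) \<partial>M) = (\<integral>\<omega>\<in>C. ?E Y \<omega> * p \<omega> \<partial>M)"
      if Y: "integrable M Y" for Y
    proof -
      have "integrable M (\<lambda>\<omega>. (p \<omega> * ?C \<omega>) * Y \<omega>)"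
        using integrable_mult_bounded[OF Y _ bnd(2)] by (simp add: mult.commute)
      from F.real_cond_exp_intg(2)[OF this] Y show ?thesis
        by (simp add: set_lebesgue_integral_def ac_simps)
    qed
    have "(\<integral>\<omega>\<in>C. f (U \<omega>) * g (V \<omega>) \<partial>M) = (\<integral>\<omega>. f (U \<omega>) * (g (V \<omega>) * ?C \<omega>) \<partial>M)"
      by (simp add: set_lebesgue_integral_def ac_simps)
    \<comment> \<open>The passage from events to f(U): the two weights g(V) and p, both cut off to
      C, have equal integrals on every event of f(U), by \<open>ci\<close> integrated over
      C.\<close>
    also have "\<dots> = (\<integral>\<omega>. f (U \<omega>) * (p \<omega> * ?C \<omega>) \<partial>M)"
    proof (rule integral_mult_eqI)
      show "integrable M (\<lambda>\<omega>. g (V \<omega>) * ?C \<omega>)" "integrable M (\<lambda>\<omega>. p \<omega> * ?C \<omega>)"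
        using bnd by (auto intro: integrable_const_bound[of _ 1])
      show "integrable M (\<lambda>\<omega>. f (U \<omega>) * (g (V \<omega>) * ?C \<omega>))"
        "integrable M (\<lambda>\<omega>. f (U \<omega>) * (p \<omega> * ?C \<omega>))"
        by (auto intro!: integrable_mult_bounded int bnd)
    next
      fix A :: "real set" assume A[measurable]: "A \<in> sets borel"
      let ?Y = "\<lambda>\<omega>. indicat_real A (f (U \<omega>))"
      have Y: "integrable M ?Y"
        by (rule integrable_const_bound[of _ 1]) (auto simp: indicator_def)
      have Yg: "integrable M (\<lambda>\<omega>. ?Y \<omega> * g (V \<omega>))"
        by (rule integrable_mult_bounded[OF Y _ g1]) measurable
      have "(\<integral>\<omega>. ?Y \<omega> * (g (V \<omega>) * ?C \<omega>) \<partial>M) = (\<integral>\<omega>\<in>C. ?Y \<omega> * g (V \<omega>) \<partial>M)"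
        by (simp add: set_lebesgue_integral_def ac_simps)
      also have "\<dots> = (\<integral>\<omega>\<in>C. ?E (\<lambda>\<omega>. ?Y \<omega> * g (V \<omega>)) \<omega> \<partial>M)"
        by (rule F.real_cond_exp_intA[OF Yg C])
      also have "\<dots> = (\<integral>\<omega>\<in>C. ?E ?Y \<omega> * p \<omega> \<partial>M)"
        unfolding set_lebesgue_integral_def using ci[OF A] by (intro integral_cong_AE) auto
      also have "\<dots> = (\<integral>\<omega>. ?Y \<omega> * (p \<omega> * ?C \<omega>) \<partial>M)"
        by (rule swap[OF Y, symmetric])
      finally show "(\<integral>\<omega>. ?Y \<omega> * (g (V \<omega>) * ?C \<omega>) \<partial>M) = (\<integral>\<omega>. ?Y \<omega> * (p \<omega> * ?C \<omega>) \<partial>M)" .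
    qed measurable
    also have "\<dots> = (\<integral>\<omega>\<in>C. ?E (\<lambda>\<omega>. f (U \<omega>)) \<omega> * p \<omega> \<partial>M)"
      by (rule swap[OF int])
    finally show "(\<integral>\<omega>\<in>C. f (U \<omega>) * g (V \<omega>) \<partial>M) = \<dots>" .
  qed
qed

section \<open>Regression on the observed units\<close>

text \<open>Condition first on (R, Z), where R can be pulled out, and then on Z, where h(1, Z) can
  be pulled out; the tower property joins the two. Second countability makes the Borel sigma-algebra
  of the pair the product one.\<close>

lemma real_cond_exp_mult_binary:
  fixes Z :: "'a \<Rightarrow> 'b::second_countable_topology"
  assumes Y: "integrable M Y"
    and [measurable]: "R \<in> borel_measurable M" "Z \<in> borel_measurable M"
    and R01: "\<forall>\<omega>\<in>space M. R \<omega> \<in> {0, 1}"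
  shows "AE \<omega> in M. real_cond_exp M (sigma_gen M Z) (\<lambda>\<omega>. Y \<omega> * R \<omega>) \<omega> =
    cond_exp_at M (\<lambda>\<omega>. (R \<omega>, Z \<omega>)) Y (1, Z \<omega>) * real_cond_exp M (sigma_gen M Z) R \<omega>"
proof -
  let ?F = "sigma_gen M Z" and ?G = "sigma_gen M (\<lambda>\<omega>. (R \<omega>, Z \<omega>))"
  define h where "h = cond_exp_at M (\<lambda>\<omega>. (R \<omega>, Z \<omega>)) Y"
  interpret F: finite_measure_subalgebra M ?F
    by (rule finite_measure_subalgebra_sigma_gen) fact
  interpret G: finite_measure_subalgebra M ?G
    by (rule finite_measure_subalgebra_sigma_gen) measurable
  have [measurable]: "h \<in> borel_measurable borel"
    unfolding h_def by (rule cond_exp_at_version)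
  have h: "AE \<omega> in M. h (R \<omega>, Z \<omega>) = real_cond_exp M ?G Y \<omega>"
    unfolding h_def by (rule cond_exp_at_version)
  have RZ: "R \<in> borel_measurable ?G" "Z \<in> borel_measurable ?G"
    using measurable_sigma_gen[of "\<lambda>\<omega>. (R \<omega>, Z \<omega>)" M]
    by (auto simp: borel_prod[symmetric] measurable_pair_iff comp_def)
  have FG: "subalgebra ?G ?F"
    using sets_sigma_gen_subset[OF RZ(2)] by (auto simp: subalgebra_def)
  have [measurable]: "(\<lambda>\<omega>. h (1, Z \<omega>)) \<in> borel_measurable ?F"
    using measurable_sigma_gen[of Z M] by measurable
  have [measurable]: "(\<lambda>\<omega>. h (1, Z \<omega>)) \<in> borel_measurable M"
    by measurable
  have YR: "integrable M (\<lambda>\<omega>. Y \<omega> * R \<omega>)"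
    by (rule integrable_mult_bounded[OF Y]) (auto dest!: bspec[OF R01])
  have "AE \<omega> in M. real_cond_exp M ?G (\<lambda>\<omega>. R \<omega> * Y \<omega>) \<omega> = R \<omega> * real_cond_exp M ?G Y \<omega>"
    using Y YR RZ by (intro G.real_cond_exp_mult) (auto simp: mult.commute)
  \<comment> \<open>Where R = 0 both sides vanish, and where R = 1 the pair (R, Z) is (1, Z). Hence
    the values of h at (0, z) never enter.\<close>
  with h have eq: "AE \<omega> in M. real_cond_exp M ?G (\<lambda>\<omega>. Y \<omega> * R \<omega>) \<omega> = h (1, Z \<omega>) * R \<omega>"
    using AE_space by eventually_elim (auto dest!: bspec[OF R01] simp: mult.commute)
  \<comment> \<open>Integrability is inherited from the conditional expectation of Y R. It is
    available for the product only, since h(1, Z) alone may fail to be integrable.\<close>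
  have "integrable M (\<lambda>\<omega>. h (1, Z \<omega>) * R \<omega>)"
    by (rule integrable_cong_AE_imp[OF G.real_cond_exp_int(1)[OF YR]]) (use eq in auto)
  then have "AE \<omega> in M. real_cond_exp M ?F (\<lambda>\<omega>. h (1, Z \<omega>) * R \<omega>) \<omega> =
      h (1, Z \<omega>) * real_cond_exp M ?F R \<omega>"
    by (intro F.real_cond_exp_mult) auto
  moreover have "AE \<omega> in M. real_cond_exp M ?F (real_cond_exp M ?G (\<lambda>\<omega>. Y \<omega> * R \<omega>)) \<omega> =
      real_cond_exp M ?F (\<lambda>\<omega>. h (1, Z \<omega>) * R \<omega>) \<omega>"
    using eq by (rule F.real_cond_exp_cong) auto
  moreover have "AE \<omega> in M. real_cond_exp M ?F (real_cond_exp M ?G (\<lambda>\<omega>. Y \<omega> * R \<omega>)) \<omega> =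
      real_cond_exp M ?F (\<lambda>\<omega>. Y \<omega> * R \<omega>) \<omega>"
    by (rule F.real_cond_exp_nested_subalg[OF G.subalg FG YR])
  ultimately show ?thesis
    unfolding h_def by eventually_elim simp
qed

text \<open>The uniform measure on the event R = 1 has density R / E[R], because R is the indicator
  of that event and E[R] is its probability.\<close>

lemma cond_exp_event_binary:
  assumes Y: "integrable M Y" and [measurable]: "R \<in> borel_measurable M"
    and R01: "\<forall>\<omega>\<in>space M. R \<omega> \<in> {0, 1}" and pos: "(\<integral>\<omega>. R \<omega> \<partial>M) > 0"
  shows "cond_exp_event M Y {\<omega> \<in> space M. R \<omega> = 1} = (\<integral>\<omega>. Y \<omega> * R \<omega> \<partial>M) / (\<integral>\<omega>. R \<omega> \<partial>M)"
proof -
  let ?A = "{\<omega> \<in> space M. R \<omega> = 1}"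
  have R: "(\<integral>\<omega>. R \<omega> \<partial>M) = prob ?A"
  proof -
    have "(\<integral>\<omega>. R \<omega> \<partial>M) = (\<integral>\<omega>. indicat_real ?A \<omega> \<partial>M)"
      by (rule Bochner_Integration.integral_cong) (auto dest!: bspec[OF R01] simp: indicator_def)
    then show ?thesis by simp
  qed
  have "cond_exp_event M Y ?A =
      integral\<^sup>L (density M (\<lambda>\<omega>. ennreal (indicat_real ?A \<omega> / prob ?A))) Y"
    using pos unfolding R cond_exp_event_def uniform_measure_def
    by (simp add: emeasure_eq_measure divide_ennreal flip: ennreal_indicator)
  also have "\<dots> = (\<integral>\<omega>. indicat_real ?A \<omega> / prob ?A * Y \<omega> \<partial>M)"
    using Y by (subst integral_real_density) auto
  also have "\<dots> = (\<integral>\<omega>. Y \<omega> * R \<omega> / prob ?A \<partial>M)"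
    by (rule Bochner_Integration.integral_cong) (auto dest!: bspec[OF R01] simp: indicator_def)
  finally show ?thesis
    by (simp add: R)
qed

text \<open>With a constant response probability, the identity of
  \<open>real_cond_exp_mult_binary\<close> can be divided by it, which exhibits h(1, Z) as a
  multiple of a conditional expectation. Integrability thus comes together with the value, and both
  are needed to integrate a difference of two such functions.\<close>

lemma has_integral_cond_exp_at_binary:
  fixes Z :: "'a \<Rightarrow> 'b::second_countable_topology"
  assumes Y: "integrable M Y"
    and R[measurable]: "R \<in> borel_measurable M" and Z[measurable]: "Z \<in> borel_measurable M"
    and R01: "\<forall>\<omega>\<in>space M. R \<omega> \<in> {0, 1}" and pos: "(\<integral>\<omega>. R \<omega> \<partial>M) > 0"
    and const: "AE \<omega> in M. real_cond_exp M (sigma_gen M Z) R \<omega> = (\<integral>\<omega>. R \<omega> \<partial>M)"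
  shows "has_bochner_integral M (\<lambda>\<omega>. cond_exp_at M (\<lambda>\<omega>. (R \<omega>, Z \<omega>)) Y (1, Z \<omega>))
    (cond_exp_event M Y {\<omega> \<in> space M. R \<omega> = 1})"
proof -
  let ?E = "real_cond_exp M (sigma_gen M Z) (\<lambda>\<omega>. Y \<omega> * R \<omega>)"
  interpret F: finite_measure_subalgebra M "sigma_gen M Z"
    by (rule finite_measure_subalgebra_sigma_gen) fact
  note [measurable] = cond_exp_at_version(1)
  have YR: "integrable M (\<lambda>\<omega>. Y \<omega> * R \<omega>)"
    by (rule integrable_mult_bounded[OF Y]) (auto dest!: bspec[OF R01])
  have "has_bochner_integral M (\<lambda>\<omega>. ?E \<omega> / (\<integral>\<omega>. R \<omega> \<partial>M))
      ((\<integral>\<omega>. Y \<omega> * R \<omega> \<partial>M) / (\<integral>\<omega>. R \<omega> \<partial>M))"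
    using F.real_cond_exp_int[OF YR] pos by (simp add: has_bochner_integral_iff)
  moreover have "AE \<omega> in M. ?E \<omega> / (\<integral>\<omega>. R \<omega> \<partial>M) =
      cond_exp_at M (\<lambda>\<omega>. (R \<omega>, Z \<omega>)) Y (1, Z \<omega>)"
    using real_cond_exp_mult_binary[OF Y R Z R01] const
    by eventually_elim (use pos in simp)
  ultimately show ?thesis
    unfolding cond_exp_event_binary[OF Y R R01 pos]
    by (subst (asm) has_bochner_integral_cong_AE) auto
qed

end

section \<open>The four assertions on the estimands\<close>

theorem corollary3p1:
  fixes M :: "'w measure"
    and Y1 Y0 R1 R0 :: "'w \<Rightarrow> real"
    and X :: "'w \<Rightarrow> real ^ 'k"
  assumes "prob_space M"
    and "integrable M Y1" and "integrable M Y0"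
    and "R1 \<in> borel_measurable M" and "R0 \<in> borel_measurable M"
    and "\<forall>\<omega>\<in>space M. R1 \<omega> \<in> {0, 1}" and "\<forall>\<omega>\<in>space M. R0 \<omega> \<in> {0, 1}"
    and "(\<integral>\<omega>. R1 \<omega> \<partial>M) > 0" and "(\<integral>\<omega>. R0 \<omega> \<partial>M) > 0"
    and "X \<in> borel_measurable M"
  shows
    "(indep_rv M (\<lambda>\<omega>. (Y1 \<omega>, Y0 \<omega>)) (\<lambda>\<omega>. (R1 \<omega>, R0 \<omega>))
        \<longrightarrow> theta_obs M Y1 Y0 R1 R0 = theta M Y1 Y0)
     \<and> (cond_indep_rv M (\<lambda>\<omega>. (Y1 \<omega>, Y0 \<omega>)) (\<lambda>\<omega>. (R1 \<omega>, R0 \<omega>)) X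
        \<longrightarrow> theta_drop M Y1 Y0 R1 R0 X = (\<integral>\<omega>. tau M Y1 Y0 X (X \<omega>) * rho M R1 R0 X (X \<omega>) \<partial>M))
     \<and> (indep_rv M X (\<lambda>\<omega>. (R1 \<omega>, R0 \<omega>))
        \<longrightarrow> theta_drop M Y1 Y0 R1 R0 X = theta_obs M Y1 Y0 R1 R0)
     \<and> (indep_rv M X (\<lambda>\<omega>. (R1 \<omega>, R0 \<omega>))
          \<and> (indep_rv M (\<lambda>\<omega>. (Y1 \<omega>, Y0 \<omega>)) (\<lambda>\<omega>. (R1 \<omega>, R0 \<omega>))
             \<or> cond_indep_rv M (\<lambda>\<omega>. (Y1 \<omega>, Y0 \<omega>)) (\<lambda>\<omega>. (R1 \<omega>, R0 \<omega>)) X)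
        \<longrightarrow> theta_drop M Y1 Y0 R1 R0 X = theta M Y1 Y0)"
proof -
  interpret prob_space M by fact
  note Y1 [measurable] = assms(2) and Y0 [measurable] = assms(3)
    and R1 [measurable] = assms(4) and R0 [measurable] = assms(5) and X [measurable] = assms(10)
  note R1_01 = assms(6) and R0_01 = assms(7) and pos1 = assms(8)
    and pos0 = assms(9)
  have intR: "integrable M R1" "integrable M R0"
    using R1_01 R0_01 by (auto intro: integrable_binary)
  note [measurable] = cond_exp_at_version(1)
  let ?F = "sigma_gen M X"
  let ?U = "\<lambda>\<omega>. (Y1 \<omega>, Y0 \<omega>)" and ?V = "\<lambda>\<omega>. (R1 \<omega>, R0 \<omega>)"
  let ?p1 = "real_cond_exp M ?F R1" and ?p0 = "real_cond_exp M ?F R0"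
  let ?c = "\<integral>\<omega>. ?p0 \<omega> * ?p1 \<omega> \<partial>M"
  let ?h1 = "\<lambda>\<omega>. cond_exp_at M (\<lambda>\<omega>. (R1 \<omega>, X \<omega>)) Y1 (1, X \<omega>)"
  let ?h0 = "\<lambda>\<omega>. cond_exp_at M (\<lambda>\<omega>. (R0 \<omega>, X \<omega>)) Y0 (1, X \<omega>)"
  interpret F: finite_measure_subalgebra M ?F
    by (rule finite_measure_subalgebra_sigma_gen) fact
  have U [measurable]: "?U \<in> borel_measurable M" and V [measurable]: "?V \<in> borel_measurable M"
    by measurable
  \<comment> \<open>The assumptions concern the pairs of potential variables. The projections single
    out one arm: \<open>fst\<close> for treatment, \<open>snd\<close> for control.\<close>
  have proj [measurable]: "fst \<in> borel_measurable (borel :: (real \<times> real) measure)"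
    "snd \<in> borel_measurable (borel :: (real \<times> real) measure)"
    by (auto intro!: borel_measurable_continuous_onI continuous_intros)
  have rho: "AE \<omega> in M. rho M R1 R0 X (X \<omega>) = ?p0 \<omega> * ?p1 \<omega> / ?c"
    using cond_exp_at_version(2)[of M X R0] cond_exp_at_version(2)[of M X R1]
    by eventually_elim (simp add: rho_def)
  have tau: "AE \<omega> in M. tau M Y1 Y0 X (X \<omega>) = real_cond_exp M ?F Y1 \<omega> - real_cond_exp M ?F Y0 \<omega>"
    using cond_exp_at_version(2)[of M X "\<lambda>\<omega>. Y1 \<omega> - Y0 \<omega>"] F.real_cond_exp_diff[OF Y1 Y0]
    by eventually_elim (simp add: tau_def)
  have [measurable]: "(\<lambda>\<omega>. rho M R1 R0 X (X \<omega>)) \<in> borel_measurable M"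
    "(\<lambda>\<omega>. tau M Y1 Y0 X (X \<omega>)) \<in> borel_measurable M"
    "(\<lambda>\<omega>. tau_obs M Y1 Y0 R1 R0 X (X \<omega>)) \<in> borel_measurable M"
    unfolding rho_def tau_def tau_obs_def by measurable

  have a: "theta_obs M Y1 Y0 R1 R0 = theta M Y1 Y0" if ind: "indep_rv M ?U ?V"
  proof -
    have "indep_var borel Y1 borel R1" "indep_var borel Y0 borel R0"
      using indep_rv_compose[OF ind U V proj(1) proj(1)] indep_rv_compose[OF ind U V proj(2) proj(2)]
      by simp_all
    then have "(\<integral>\<omega>. Y1 \<omega> * R1 \<omega> \<partial>M) = (\<integral>\<omega>. Y1 \<omega> \<partial>M) * (\<integral>\<omega>. R1 \<omega> \<partial>M)"
      "(\<integral>\<omega>. Y0 \<omega> * R0 \<omega> \<partial>M) = (\<integral>\<omega>. Y0 \<omega> \<partial>M) * (\<integral>\<omega>. R0 \<omega> \<partial>M)"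
      using Y1 Y0 intR by (auto intro: indep_var_lebesgue_integral)
    then show ?thesis
      unfolding theta_obs_def theta_def cond_exp_event_binary[OF Y1 R1 R1_01 pos1]
        cond_exp_event_binary[OF Y0 R0 R0_01 pos0]
      using Y1 Y0 pos1 pos0 by simp
  qed

  have b: "theta_drop M Y1 Y0 R1 R0 X = (\<integral>\<omega>. tau M Y1 Y0 X (X \<omega>) * rho M R1 R0 X (X \<omega>) \<partial>M)"
    if ind: "cond_indep_rv M ?U ?V X"
  proof -
    \<comment> \<open>Two expressions for E[Y(d) R(d) | X] are equated, one from regression on the
      observed units and one from conditional independence. The factor \<open>?p1\<close> cannot be
      cancelled, as it may vanish.\<close>
    have "AE \<omega> in M. ?h1 \<omega> * ?p1 \<omega> = real_cond_exp M ?F Y1 \<omega> * ?p1 \<omega>"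
      using real_cond_exp_mult_binary[OF Y1 R1 X R1_01]
        real_cond_exp_cond_indep[OF ind U V X proj(1) proj(1)] Y1 R1_01 by auto
    moreover have "AE \<omega> in M. ?h0 \<omega> * ?p0 \<omega> = real_cond_exp M ?F Y0 \<omega> * ?p0 \<omega>"
      using real_cond_exp_mult_binary[OF Y0 R0 X R0_01]
        real_cond_exp_cond_indep[OF ind U V X proj(2) proj(2)] Y0 R0_01 by auto
    ultimately have "AE \<omega> in M. tau_obs M Y1 Y0 R1 R0 X (X \<omega>) * rho M R1 R0 X (X \<omega>) =
        tau M Y1 Y0 X (X \<omega>) * rho M R1 R0 X (X \<omega>)"
      using rho tau
    proof eventually_elim
      case (elim \<omega>)
      \<comment> \<open>The weight \<open>?p0 * ?p1\<close> supplies each arm with its own response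
        probability. The integrands then agree pointwise almost everywhere, so no integrability is
        required, and dividing by \<open>?c\<close> is harmless even if \<open>?c\<close> is
        0.\<close>
      have "(?h1 \<omega> - ?h0 \<omega>) * (?p0 \<omega> * ?p1 \<omega>) = ?h1 \<omega> * ?p1 \<omega> * ?p0 \<omega> - ?h0 \<omega> * ?p0 \<omega> * ?p1 \<omega>"
        by (simp add: algebra_simps)
      also have "\<dots> = (real_cond_exp M ?F Y1 \<omega> - real_cond_exp M ?F Y0 \<omega>) * (?p0 \<omega> * ?p1 \<omega>)"
        unfolding elim by (simp add: algebra_simps)
      finally show ?case
        unfolding elim tau_obs_def times_divide_eq_right by (rule arg_cong)
    qed
    then show ?thesis
      unfolding theta_drop_def by (intro integral_cong_AE) auto
  qed

  have p: "AE \<omega> in M. ?p1 \<omega> = (\<integral>\<omega>. R1 \<omega> \<partial>M)" "AE \<omega> in M. ?p0 \<omega> = (\<integral>\<omega>. R0 \<omega> \<partial>M)"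
    if ind: "indep_rv M X ?V"
    using real_cond_exp_indep[OF ind X V proj(1)] real_cond_exp_indep[OF ind X V proj(2)] intR
    by simp_all

  have rho1: "AE \<omega> in M. rho M R1 R0 X (X \<omega>) = 1" if ind: "indep_rv M X ?V"
  proof -
    \<comment> \<open>With both response probabilities constant, the normalizing constant is E[R(0)]
      E[R(1)], which is positive, so the quotient defining the weight is 1.\<close>
    have "?c = (\<integral>\<omega>. (\<integral>\<omega>. R0 \<omega> \<partial>M) * (\<integral>\<omega>. R1 \<omega> \<partial>M) \<partial>M)"
      by (rule integral_cong_AE) (use p[OF ind] in auto)
    then have c: "?c = (\<integral>\<omega>. R0 \<omega> \<partial>M) * (\<integral>\<omega>. R1 \<omega> \<partial>M)"
      by (simp add: prob_space)
    from rho p[OF ind] show ?thesis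
      by eventually_elim (use c pos1 pos0 in simp)
  qed

  have c: "theta_drop M Y1 Y0 R1 R0 X = theta_obs M Y1 Y0 R1 R0" if ind: "indep_rv M X ?V"
  proof -
    have "theta_drop M Y1 Y0 R1 R0 X = (\<integral>\<omega>. ?h1 \<omega> - ?h0 \<omega> \<partial>M)"
      unfolding theta_drop_def tau_obs_def
      by (rule integral_cong_AE) (use rho1[OF ind] in auto)
    also have "\<dots> = theta_obs M Y1 Y0 R1 R0"
      unfolding theta_obs_def
      by (intro has_bochner_integral_integral_eq has_bochner_integral_diff
          has_integral_cond_exp_at_binary Y1 Y0 R1 R0 X R1_01 R0_01 pos1 pos0 p[OF ind])
    finally show ?thesis .
  qed

  \<comment> \<open>Only the conditional alternative of (d) is treated here: the weight in (b) is 1,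
    and E[Y(d) | X] integrates to E[Y(d)]. Under the unconditional alternative, (d) is (c) followed
    by (a).\<close>
  have d: "theta_drop M Y1 Y0 R1 R0 X = theta M Y1 Y0"
    if ind: "indep_rv M X ?V" and cind: "cond_indep_rv M ?U ?V X"
  proof -
    have "theta_drop M Y1 Y0 R1 R0 X =
        (\<integral>\<omega>. real_cond_exp M ?F Y1 \<omega> - real_cond_exp M ?F Y0 \<omega> \<partial>M)"
      unfolding b[OF cind] by (rule integral_cong_AE) (use rho1[OF ind] tau in auto)
    also have "\<dots> = theta M Y1 Y0"
      unfolding theta_def using F.real_cond_exp_int[OF Y1] F.real_cond_exp_int[OF Y0] Y1 Y0 by simp
    finally show ?thesis .
  qed

  show ?thesis
    using a b c d by auto
qed

end
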